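(* Let $a<b$ and $c<d$ be real numbers, let $\Delta=[a,b]\times[c,d]$, and let $F:\Delta\to\mathbb{R}_{\mathcal{I}}^{+}$ be an interval-valued co-ordinated convex function on $\Delta$, with $F(x,y)=[\underline{F}(x,y),\overline{F}(x,y)]$. Then the following chain of inclusions holds: \begin{align*} F\left(\frac{a+b}{2},\frac{c+d}{2}\right) &\supseteq \frac12\left[\frac{1}{b-a}\int_a^b F\left(x,\frac{c+d}{2}\right)dx+\frac{1}{d-c}\int_c^d F\left(\frac{a+b}{2},y\right)dy\right]\\ &\supseteq \frac{1}{(b-a)(d-c)}\int_a^b\int_c^d F(x,y)\,dy\,dx\\ &\supseteq \frac14\left[\frac{1}{b-a}\int_a^b F(x,c)\,dx+\frac{1}{b-a}\int_a^b F(x,d)\,dx+\frac{1}{d-c}\int_c^d F(a,y)\,dy+\frac{1}{d-c}\int_c^d F(b,y)\,dy\right]\\ &\supseteq \frac{F(a,c)+F(a,d)+F(b,c)+F(b,d)}{4}. \end{align*}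
   Context: $\mathbb{R}_{\mathcal{I}}^{+}$ denotes the family of all positive closed bounded intervals $X=[\underline{X},\overline{X}]$ of $\mathbb{R}$, i.e. $0<\underline{X}\le\overline{X}$ (degenerate intervals $\underline{X}=\overline{X}$ are allowed). Interval operations: $X+Y=[\underline{X}+\underline{Y},\overline{X}+\overline{Y}]$ and, for $\lambda\ge 0$, $\lambda X=[\lambda\underline{X},\lambda\overline{X}]$. The relation $\supseteq$ is set inclusion: $X\supseteq Y$ iff $\underline{X}\le\underline{Y}$ and $\overline{Y}\le\overline{X}$. A function $F:\Delta=[a,b]\times[c,d]\to\mathbb{R}_{\mathcal{I}}^{+}$ is interval-valued co-ordinated convex if for all $x,y\in[a,b]$, all $u,w\in[c,d]$ and all $s,t\in[0,1]$, $$F(tx+(1-t)y,\,su+(1-s)w)\supseteq tsF(x,u)+t(1-s)F(x,w)+s(1-t)F(y,u)+(1-s)(1-t)F(y,w).$$ Integrals are interval-valued Riemann integrals: an interval-valued function $H=[\underline{H},\overline{H}]$ on $[p,q]$ is integrable iff $\underline{H}$ and $\overline{H}$ are Riemann integrable, and then $\int_p^q H(t)\,dt=\left[\int_p^q\underline{H}(t)\,dt,\int_p^q\overline{H}(t)\,dt\right]$. The double integral over $\Delta$ is the interval-valued double Riemann integral, which equals the iterated integral. *)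

theory Defs
  imports "HOL-Analysis.Analysis" "HOL-Library.Interval"
begin

text \<open>Intervals are elements of the type \<^typ>\<open>real interval\<close> of nonempty closed bounded
  intervals; its addition is endpointwise. Its library order \<open>\<le>\<close> is inclusion as well, but the
  relation below is stated as an inclusion of the underlying point sets.\<close>

abbreviation interval_superset :: "real interval \<Rightarrow> real interval \<Rightarrow> bool"
    (infix "\<supseteq>\<^sub>I" 50)
  where "X \<supseteq>\<^sub>I Y \<equiv> set_of X \<supseteq> set_of Y"

lemma interval_superset_iff: "X \<supseteq>\<^sub>I Y \<longleftrightarrow> lower X \<le> lower Y \<and> upper Y \<le> upper X"
  by (auto simp: set_of_eq)

definition positive_interval :: "real interval \<Rightarrow> bool"
  where "positive_interval X \<longleftrightarrow> 0 < lower X"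

text \<open>The usual scalar multiple, for scalars of either sign. Only nonnegative scalars
  occur below, and for these it acts endpointwise (\<open>lower_scale\<close>, \<open>upper_scale\<close>).\<close>

definition interval_scale :: "real \<Rightarrow> real interval \<Rightarrow> real interval"  (infixr "*\<^sub>I" 75)
  where "r *\<^sub>I X = Interval (min (r * lower X) (r * upper X), max (r * lower X) (r * upper X))"

lemma lower_Interval [simp]: "l \<le> u \<Longrightarrow> lower (Interval (l, u)) = l"
  and upper_Interval [simp]: "l \<le> u \<Longrightarrow> upper (Interval (l, u)) = u"
  by (simp_all add: lower.rep_eq upper.rep_eq Interval_inverse)

lemma lower_scale: "0 \<le> r \<Longrightarrow> lower (r *\<^sub>I X) = r * lower X"
  and upper_scale: "0 \<le> r \<Longrightarrow> upper (r *\<^sub>I X) = r * upper X"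
  by (simp_all add: interval_scale_def min_def max_def mult_left_mono)

definition interval_coord_convex_on ::
    "real set \<Rightarrow> real set \<Rightarrow> (real \<Rightarrow> real \<Rightarrow> real interval) \<Rightarrow> bool"
  where "interval_coord_convex_on A B F \<longleftrightarrow>
    (\<forall>x\<in>A. \<forall>y\<in>A. \<forall>u\<in>B. \<forall>w\<in>B. \<forall>s\<in>{0..1}. \<forall>t\<in>{0..1}.
      F (t * x + (1 - t) * y) (s * u + (1 - s) * w) \<supseteq>\<^sub>I
        (t * s) *\<^sub>I F x u + (t * (1 - s)) *\<^sub>I F x w
        + (s * (1 - t)) *\<^sub>I F y u + ((1 - s) * (1 - t)) *\<^sub>I F y w)"

text \<open>The Riemann integral over a compact box \<open>S\<close>, of any dimension: the limit of the tagged
  Riemann sums as the mesh tends to 0. This is the definition of the library's gauge integral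
  with the gauges restricted to balls of constant radius. It is not meant for sets other than
  compact boxes.\<close>

definition has_riemann_integral :: "('a::euclidean_space \<Rightarrow> real) \<Rightarrow> real \<Rightarrow> 'a set \<Rightarrow> bool"
    (infixr "has'_riemann'_integral" 46)
  where "(f has_riemann_integral I) S \<longleftrightarrow>
    (\<forall>e>0. \<exists>\<delta>>0. \<forall>D. D tagged_division_of S \<and> (\<lambda>x. ball x \<delta>) fine D \<longrightarrow>
      \<bar>(\<Sum>(x, K)\<in>D. Henstock_Kurzweil_Integration.content K * f x) - I\<bar> < e)"

definition riemann_integrable_on :: "('a::euclidean_space \<Rightarrow> real) \<Rightarrow> 'a set \<Rightarrow> bool"
    (infixr "riemann'_integrable'_on" 46)
  where "f riemann_integrable_on S \<longleftrightarrow> (\<exists>I. (f has_riemann_integral I) S)"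

definition riemann_integral :: "'a::euclidean_space set \<Rightarrow> ('a \<Rightarrow> real) \<Rightarrow> real"
  where "riemann_integral S f = (THE I. (f has_riemann_integral I) S)"

definition interval_integrable_on :: "('a::euclidean_space \<Rightarrow> real interval) \<Rightarrow> 'a set \<Rightarrow> bool"
    (infixr "interval'_integrable'_on" 46)
  where "H interval_integrable_on S \<longleftrightarrow>
    (\<lambda>t. lower (H t)) riemann_integrable_on S \<and> (\<lambda>t. upper (H t)) riemann_integrable_on S"

text \<open>Meaningful only for integrable \<open>H\<close>: the pair of endpoints is then ordered, as
  \<open>lower_interval_integral\<close> and \<open>upper_interval_integral\<close> show.\<close>

definition interval_integral ::
    "'a::euclidean_space set \<Rightarrow> ('a \<Rightarrow> real interval) \<Rightarrow> real interval"
  where "interval_integral S H =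
    Interval (riemann_integral S (\<lambda>t. lower (H t)), riemann_integral S (\<lambda>t. upper (H t)))"

lemma has_riemann_integral_imp_has_integral:
  assumes "(f has_riemann_integral I) (cbox p q)"
  shows "(f has_integral I) (cbox p q)"
  unfolding has_integral
proof (intro allI impI)
  fix e :: real
  assume "0 < e"
  then obtain \<delta> where "\<delta> > 0" and \<delta>: "\<And>D. D tagged_division_of cbox p q \<Longrightarrow>
      (\<lambda>x. ball x \<delta>) fine D \<Longrightarrow> \<bar>(\<Sum>(x, K)\<in>D. Henstock_Kurzweil_Integration.content K * f x) - I\<bar> < e"
    using assms unfolding has_riemann_integral_def by meson
  then show "\<exists>\<gamma>. gauge \<gamma> \<and> (\<forall>D. D tagged_division_of cbox p q \<and> \<gamma> fine D \<longrightarrow>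
      norm ((\<Sum>(x, K)\<in>D. Henstock_Kurzweil_Integration.content K *\<^sub>R f x) - I) < e)"
    by (intro exI[of _ "\<lambda>x. ball x \<delta>"]) (auto simp: gauge_ball)
qed

lemma riemann_integral_eq:
  assumes "(f has_riemann_integral I) (cbox p q)"
  shows "riemann_integral (cbox p q) f = I"
  unfolding riemann_integral_def
proof (rule the_equality)
  fix J
  assume "(f has_riemann_integral J) (cbox p q)"
  with assms show "J = I"
    by (intro has_integral_unique[of f J "cbox p q" I] has_riemann_integral_imp_has_integral)
qed (fact assms)

lemma riemann_integrable_has_integral:
  assumes "f riemann_integrable_on cbox p q"
  shows "(f has_integral riemann_integral (cbox p q) f) (cbox p q)"
proof -
  obtain I where I: "(f has_riemann_integral I) (cbox p q)"
    using assms unfolding riemann_integrable_on_def ..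
  show ?thesis
    unfolding riemann_integral_eq[OF I] by (rule has_riemann_integral_imp_has_integral[OF I])
qed

lemma
  assumes "H interval_integrable_on cbox p q"
  shows lower_interval_integral:
      "lower (interval_integral (cbox p q) H) = riemann_integral (cbox p q) (\<lambda>t. lower (H t))"
    and upper_interval_integral:
      "upper (interval_integral (cbox p q) H) = riemann_integral (cbox p q) (\<lambda>t. upper (H t))"
proof -
  have "riemann_integral (cbox p q) (\<lambda>t. lower (H t))
      \<le> riemann_integral (cbox p q) (\<lambda>t. upper (H t))"
    using assms unfolding interval_integrable_on_def
    by (intro has_integral_le[OF riemann_integrable_has_integral riemann_integrable_has_integral])
      auto
  then show
    "lower (interval_integral (cbox p q) H) = riemann_integral (cbox p q) (\<lambda>t. lower (H t))"
    "upper (interval_integral (cbox p q) H) = riemann_integral (cbox p q) (\<lambda>t. upper (H t))"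
    by (simp_all add: interval_integral_def)
qed

end

theory Submission
  imports Defs
begin

text \<open>
  Read endpointwise, co-ordinated convexity of \<open>F\<close> says that the lower endpoint and the negated
  upper endpoint are convex in each variable separately, and an inclusion of intervals is a
  pair of real inequalities for these two functions. Hence everything reduces to one real
  function \<open>f\<close> on the rectangle that is separately convex and bounded; positivity of \<open>F\<close> enters
  as the source of the bound (\<open>interval_coord_convex_upper_le_center\<close>).

  The inequalities are the Hermite--Hadamard inequality \<open>Hermite_Hadamard\<close> for functions of one
  variable, applied to the slices of \<open>f\<close> and to the marginal \<open>\<lambda>x. \<integral> f x y dy\<close>, which inherits
  convexity from the slices. The outer two links are statements about single slices. Each of
  the middle two is an average of two inequalities: one integrates the inequalities for all
  vertical slices, and the other is the inequality for the marginal.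

  Integrability needs an argument because a convex function on a closed interval may jump at
  the ends, so that \<open>f\<close> may be discontinuous on the boundary of the rectangle. In the
  interior it is jointly continuous (\<open>continuous_on_separately_convex\<close>), and a bounded
  function that is continuous in the interior of a box is Riemann integrable
  (\<open>has_riemann_integral_bounded_continuous_interior\<close>). Fubini's theorem on the open
  rectangle then identifies the double integral with the iterated one.
\<close>

section \<open>Riemann integrability of bounded functions continuous inside a box\<close>

text \<open>A tagged Riemann sum is the integral of the step function that takes on each cell the value
  of \<open>f\<close> at its tag. The function \<open>tag\<close> chooses a cell through each point; the choice is
  forced off the frontiers of the cells, which form a negligible set. This covers degenerate
  cells inside another cell too, since they consist of frontier points only.\<close>
lemma riemann_sum_as_integral:
  fixes f :: "'a::euclidean_space \<Rightarrow> real"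
  assumes D: "D tagged_division_of cbox p q"
    and tag: "\<And>z. z \<in> cbox p q \<Longrightarrow> \<exists>K. (tag z, K) \<in> D \<and> z \<in> K"
  shows "((\<lambda>z. f (tag z)) has_integral
           (\<Sum>(x, K)\<in>D. Henstock_Kurzweil_Integration.content K * f x)) (cbox p q)"
proof -
  note DD = tagged_division_ofD[OF D]
  define N where "N = (\<Union>(x, K)\<in>D. K - interior K)"
  have N: "negligible N"
    unfolding N_def
  proof (rule negligible_Union, goal_cases)
    case 1
    then show ?case using DD(1) by simp
  next
    case (2 T)
    then obtain x K where "(x, K) \<in> D" and T: "T = K - interior K" by auto
    then obtain u v where "K = cbox u v" using DD(4) by blast
    then show ?case unfolding T by (simp add: interior_cbox negligible_frontier_interval)
  qed
  have cell: "((\<lambda>z. f (tag z)) has_integral Henstock_Kurzweil_Integration.content K * f x) K"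
    if xK: "(x, K) \<in> D" for x K
  proof -
    obtain u v where K: "K = cbox u v" using DD(4)[OF xK] by blast
    show ?thesis
    proof (rule has_integral_spike[OF N])
      show "((\<lambda>_. f x) has_integral Henstock_Kurzweil_Integration.content K * f x) K"
        using has_integral_const[of "f x" u v] by (simp add: K)
    next
      fix z
      assume z: "z \<in> K - N"
      then have "z \<in> cbox p q" using DD(3)[OF xK] by auto
      then obtain K' where K': "(tag z, K') \<in> D" "z \<in> K'" using tag by blast
      have "z \<in> interior K" "z \<in> interior K'"
        using z K' xK by (auto simp: N_def)
      then have "(tag z, K') = (x, K)"
        using DD(5)[OF K'(1) xK] by blast
      then show "f (tag z) = f x" by simp
    qed
  qed
  have "((\<lambda>z. f (tag z)) has_integral
      (\<Sum>(x, K)\<in>D. integral K (\<lambda>z. f (tag z)))) (cbox p q)"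
    using cell by (intro has_integral_combine_tagged_division[OF D]) (auto intro: integrable_integral)
  also have "(\<Sum>(x, K)\<in>D. integral K (\<lambda>z. f (tag z)))
      = (\<Sum>(x, K)\<in>D. Henstock_Kurzweil_Integration.content K * f x)"
    using cell by (intro sum.cong) (auto intro: integral_unique)
  finally show ?thesis .
qed

text \<open>The step functions of Riemann sums with mesh tending to 0 are uniformly bounded and converge
  pointwise to \<open>f\<close> where \<open>f\<close> is continuous. Since the frontier of the box is negligible,
  dominated convergence on the open box gives the limit of their integrals. The same theorem
  yields the integrability of \<open>f\<close>.\<close>
lemma riemann_sums_converge:
  fixes f :: "'a::euclidean_space \<Rightarrow> real"
  assumes bounded: "\<And>z. z \<in> cbox p q \<Longrightarrow> \<bar>f z\<bar> \<le> M"
    and cont: "continuous_on (box p q) f"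
    and D: "\<And>n. D n tagged_division_of cbox p q"
    and fine: "\<And>n. (\<lambda>x. ball x (inverse (Suc n))) fine D n"
  shows "f integrable_on cbox p q"
    and "(\<lambda>n. \<Sum>(x, K)\<in>D n. Henstock_Kurzweil_Integration.content K * f x)
           \<longlonglongrightarrow> integral (cbox p q) f"
proof -
  define tag where "tag n z = (SOME x. \<exists>K. (x, K) \<in> D n \<and> z \<in> K)" for n z
  have tag: "\<exists>K. (tag n z, K) \<in> D n \<and> z \<in> K" if "z \<in> cbox p q" for n z
    unfolding tag_def
  proof (rule someI_ex)
    show "\<exists>x K. (x, K) \<in> D n \<and> z \<in> K"
      using tagged_division_ofD(6)[OF D[of n]] that by blast
  qed
  have step: "((\<lambda>z. f (tag n z)) has_integral
      (\<Sum>(x, K)\<in>D n. Henstock_Kurzweil_Integration.content K * f x)) (box p q)" for n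
    unfolding has_integral_open_interval by (rule riemann_sum_as_integral[OF D tag])
  have in_cbox: "tag n z \<in> cbox p q" if z: "z \<in> box p q" for n z
  proof -
    obtain K where "(tag n z, K) \<in> D n"
      using tag z box_subset_cbox by blast
    then show ?thesis
      using tagged_division_ofD(2,3)[OF D[of n]] by blast
  qed
  have near: "dist (tag n z) z < inverse (Suc n)" if z: "z \<in> box p q" for n z
  proof -
    obtain K where "(tag n z, K) \<in> D n" "z \<in> K"
      using tag z box_subset_cbox by blast
    then have "z \<in> ball (tag n z) (inverse (Suc n))" using fineD[OF fine] by blast
    then show ?thesis by simp
  qed
  have tags: "(\<lambda>n. tag n z) \<longlonglongrightarrow> z" if z: "z \<in> box p q" for z
  proof (rule tendsto_dist_iff[THEN iffD2], rule tendsto_sandwich[OF _ _ tendsto_const LIMSEQ_inverse_real_of_nat])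
    show "\<forall>\<^sub>F n in sequentially. dist (tag n z) z \<le> inverse (real (Suc n))"
      using near[OF z] by (intro always_eventually allI less_imp_le)
  qed simp
  have conv: "(\<lambda>n. f (tag n z)) \<longlonglongrightarrow> f z" if z: "z \<in> box p q" for z
  proof (rule isCont_tendsto_compose[OF _ tags[OF z]])
    show "isCont f z"
      using cont z by (simp add: continuous_on_eq_continuous_at[OF open_box])
  qed
  have step_integrable: "(\<lambda>z. f (tag n z)) integrable_on box p q" for n
    using step by (rule has_integral_integrable)
  have const_integrable: "(\<lambda>_. M) integrable_on box p q"
    by (simp add: integrable_on_open_interval integrable_const)
  have step_bounded: "norm (f (tag n z)) \<le> M" if "z \<in> box p q" for n z
    using bounded[OF in_cbox[OF that]] by simp
  have *: "f integrable_on box p q"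
    by (rule dominated_convergence(1)[OF step_integrable const_integrable step_bounded conv])
  have "(\<lambda>n. integral (box p q) (\<lambda>z. f (tag n z))) \<longlonglongrightarrow> integral (box p q) f"
    by (rule dominated_convergence(2)[OF step_integrable const_integrable step_bounded conv])
  then show "(\<lambda>n. \<Sum>(x, K)\<in>D n. Henstock_Kurzweil_Integration.content K * f x)
           \<longlonglongrightarrow> integral (cbox p q) f"
    unfolding integral_unique[OF step] by (simp only: integral_open_interval)
  show "f integrable_on cbox p q"
    using * by (simp add: integrable_on_open_interval)
qed

text \<open>Were the mesh limit to fail, some tolerance \<open>e\<close> would be missed by divisions of every mesh
  \<open>1 / (n + 1)\<close>; the Riemann sums of this sequence of divisions would not converge.\<close>
lemma
  fixes f :: "'a::euclidean_space \<Rightarrow> real"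
  assumes bounded: "\<And>z. z \<in> cbox p q \<Longrightarrow> \<bar>f z\<bar> \<le> M"
    and cont: "continuous_on (box p q) f"
  shows integrable_on_bounded_continuous_interior: "f integrable_on cbox p q"
    and has_riemann_integral_bounded_continuous_interior:
      "(f has_riemann_integral integral (cbox p q) f) (cbox p q)"
proof -
  have "\<exists>D. D tagged_division_of cbox p q \<and> (\<lambda>x. ball x (inverse (Suc n))) fine D" for n
    by (rule fine_division_exists[of "\<lambda>x. ball x (inverse (Suc n))" p q]) (auto intro: gauge_ball)
  then obtain D where D: "\<And>n. D n tagged_division_of cbox p q"
    "\<And>n. (\<lambda>x. ball x (inverse (Suc n))) fine D n"
    by metis
  show "f integrable_on cbox p q"
    by (rule riemann_sums_converge(1)[OF bounded cont D])
  show "(f has_riemann_integral integral (cbox p q) f) (cbox p q)"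
    unfolding has_riemann_integral_def
  proof (intro allI impI)
    define S where "S = (\<lambda>D :: ('a \<times> 'a set) set. \<Sum>(x, K)\<in>D. Henstock_Kurzweil_Integration.content K * f x)"
    define mesh where
      "mesh = (\<lambda>\<delta> D. D tagged_division_of cbox p q \<and> (\<lambda>x. ball x \<delta>) fine D)"
    fix e :: real
    assume "e > 0"
    have "\<exists>\<delta>>0. \<forall>D. mesh \<delta> D \<longrightarrow> \<bar>S D - integral (cbox p q) f\<bar> < e"
    proof (rule ccontr)
      assume no: "\<not> (\<exists>\<delta>>0. \<forall>D. mesh \<delta> D \<longrightarrow> \<bar>S D - integral (cbox p q) f\<bar> < e)"
      have "\<exists>D. mesh (inverse (Suc n)) D \<and> \<not> \<bar>S D - integral (cbox p q) f\<bar> < e" for n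
      proof -
        have "0 < inverse (real (Suc n))" by simp
        with no show ?thesis by blast
      qed
      then obtain D where mesh_D: "\<And>n. mesh (inverse (Suc n)) (D n)"
        and far: "\<And>n. \<not> \<bar>S (D n) - integral (cbox p q) f\<bar> < e"
        by metis
      have "(\<lambda>n. S (D n)) \<longlonglongrightarrow> integral (cbox p q) f"
        unfolding S_def
        by (rule riemann_sums_converge(2)[OF bounded cont]) (use mesh_D in \<open>simp_all add: mesh_def\<close>)
      from LIMSEQ_D[OF this \<open>e > 0\<close>] far show False
        by (metis order_refl real_norm_def)
    qed
    then show "\<exists>\<delta>>0. \<forall>D. D tagged_division_of cbox p q \<and> (\<lambda>x. ball x \<delta>) fine D \<longrightarrow>
        \<bar>(\<Sum>(x, K)\<in>D. Henstock_Kurzweil_Integration.content K * f x) - integral (cbox p q) f\<bar> < e"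
      unfolding mesh_def S_def .
  qed
qed

lemma has_riemann_integral_cong:
  assumes "\<And>x. x \<in> S \<Longrightarrow> f x = g x"
  shows "(f has_riemann_integral I) S \<longleftrightarrow> (g has_riemann_integral I) S"
proof -
  have "(\<Sum>(x, K)\<in>D. Henstock_Kurzweil_Integration.content K * f x)
      = (\<Sum>(x, K)\<in>D. Henstock_Kurzweil_Integration.content K * g x)"
    if "D tagged_division_of S" for D
  proof (rule sum.cong[OF refl], clarify)
    fix x K
    assume "(x, K) \<in> D"
    then have "x \<in> S" using tagged_division_ofD(2,3)[OF that] by blast
    then show "Henstock_Kurzweil_Integration.content K * f x
        = Henstock_Kurzweil_Integration.content K * g x"
      by (simp add: assms)
  qed
  then show ?thesis unfolding has_riemann_integral_def by simp
qed

lemma has_riemann_integral_minus: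
  fixes f :: "'a::euclidean_space \<Rightarrow> real"
  assumes "(f has_riemann_integral I) S"
  shows "((\<lambda>x. - f x) has_riemann_integral - I) S"
proof -
  have "(\<Sum>(x, K)\<in>D. Henstock_Kurzweil_Integration.content K * - f x)
      = - (\<Sum>(x, K)\<in>D. Henstock_Kurzweil_Integration.content K * f x)" for D :: "('a \<times> 'a set) set"
    by (simp add: case_prod_unfold sum_negf)
  moreover have "\<bar>- S - (- I)\<bar> = \<bar>S - I\<bar>" for S by simp
  ultimately show ?thesis
    using assms unfolding has_riemann_integral_def by (simp only:)
qed

section \<open>Double integrals as iterated integrals\<close>

text \<open>Continuity on the open box makes the extension \<open>h\<close> of \<open>f\<close> by zero Borel measurable, so that
  Fubini's theorem for Lebesgue measure applies to it. On the boundary \<open>f\<close> is arbitrary: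
  it does not affect the double integral, and in the iterated one it affects only the outer
  integrand on the negligible frontier of \<open>cbox a b\<close>.\<close>
lemma integral_box_Pair_iterated:
  fixes f :: "'a::euclidean_space \<times> 'b::euclidean_space \<Rightarrow> real"
  assumes bounded: "\<And>z. z \<in> box (a, c) (b, d) \<Longrightarrow> \<bar>f z\<bar> \<le> M"
    and cont: "continuous_on (box (a, c) (b, d)) f"
  shows "integral (cbox (a, c) (b, d)) f
    = integral (cbox a b) (\<lambda>x. integral (cbox c d) (\<lambda>y. f (x, y)))"
proof -
  define h where "h = (\<lambda>z. indicator (box (a, c) (b, d)) z *\<^sub>R f z)"
  have h_restrict: "h = (\<lambda>z. if z \<in> box (a, c) (b, d) then f z else 0)"
    by (auto simp: h_def fun_eq_iff)
  have meas[measurable]: "h \<in> borel_measurable borel"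
    unfolding h_def by (rule borel_measurable_continuous_on_indicator) (use cont in \<open>simp_all only: borel_open[OF open_box]\<close>)
  have M: "\<bar>h z\<bar> \<le> M" if "z \<in> box (a, c) (b, d)" for z
    using bounded[OF that] by (simp add: h_restrict that)
  have int: "integrable lborel h"
  proof (rule integrableI_bounded_set[where A="box (a, c) (b, d)" and B=M])
    show "AE z in lborel. z \<notin> box (a, c) (b, d) \<longrightarrow> h z = 0"
      by (simp add: h_restrict)
  qed (use M in \<open>simp_all add: emeasure_lborel_box_eq\<close>)
  then have int': "integrable (lborel \<Otimes>\<^sub>M lborel) h" by (simp add: lborel_prod)
  have slice: "integrable lborel (\<lambda>y. h (x, y))" for x
  \<comment> \<open>If the box is empty, \<open>M\<close> may be negative, hence \<open>\<bar>M\<bar>\<close>.\<close>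
  proof (rule integrableI_bounded_set[where A="box c d" and B="\<bar>M\<bar>"])
    have "\<bar>h (x, y)\<bar> \<le> \<bar>M\<bar>" for y
      using M[of "(x, y)"] by (cases "(x, y) \<in> box (a, c) (b, d)") (simp_all add: h_restrict)
    then show "AE y in lborel. y \<in> box c d \<longrightarrow> norm (h (x, y)) \<le> \<bar>M\<bar>"
      by simp
    show "AE y in lborel. y \<notin> box c d \<longrightarrow> h (x, y) = 0"
      by (simp add: h_restrict box_prod)
  qed (simp_all add: emeasure_lborel_box_eq)
  have "integral (cbox (a, c) (b, d)) f = integral UNIV h"
    unfolding integral_open_interval[symmetric] h_restrict by (rule integral_restrict_UNIV[symmetric])
  also have "\<dots> = (\<integral>z. h z \<partial>(lborel \<Otimes>\<^sub>M lborel))"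
    by (simp add: integral_lborel[OF int] lborel_prod)
  also have "\<dots> = (\<integral>x. \<integral>y. h (x, y) \<partial>lborel \<partial>lborel)"
    by (rule lborel_pair.integral_fst'[OF int', symmetric])
  also have "\<dots> = integral UNIV (\<lambda>x. \<integral>y. h (x, y) \<partial>lborel)"
    by (rule integral_lborel[OF lborel_pair.integrable_fst'[OF int'], symmetric])
  also have "(\<lambda>x. \<integral>y. h (x, y) \<partial>lborel)
      = (\<lambda>x. if x \<in> box a b then integral (box c d) (\<lambda>y. f (x, y)) else 0)"
  proof
    fix x
    have "(\<integral>y. h (x, y) \<partial>lborel) = integral UNIV (\<lambda>y. h (x, y))"
      by (rule integral_lborel[OF slice, symmetric])
    also have "\<dots> = integral UNIV
        (\<lambda>y. if y \<in> box c d then if x \<in> box a b then f (x, y) else 0 else 0)"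
      by (rule arg_cong[where f="integral UNIV"]) (auto simp: h_restrict box_prod)
    also have "\<dots> = (if x \<in> box a b then integral (box c d) (\<lambda>y. f (x, y)) else 0)"
      unfolding integral_restrict_UNIV by simp
    finally show "(\<integral>y. h (x, y) \<partial>lborel) = \<dots>" .
  qed
  finally show ?thesis
    by (simp add: integral_restrict_UNIV integral_open_interval)
qed

section \<open>Convex and separately convex functions\<close>

text \<open>Each of the two one-sided estimates compares the difference with a chord of length at least
  \<open>e\<close>, namely one that reaches from \<open>x0\<close> or from \<open>x\<close> to an end of the interval; the slope of
  such a chord is at most \<open>2 * M / e\<close>. Only \<open>x0\<close> has to keep away from the ends, and the
  constant depends on the function through \<open>M\<close> alone. That uniformity is what joint
  continuity requires below.\<close>
lemma convex_on_diff_bound: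
  fixes \<phi> :: "real \<Rightarrow> real"
  assumes conv: "convex_on {a..b} \<phi>" and M: "\<And>x. x \<in> {a..b} \<Longrightarrow> \<bar>\<phi> x\<bar> \<le> M"
    and e: "0 < e" "a + e \<le> x0" "x0 \<le> b - e" and x: "x \<in> {a..b}"
  shows "\<bar>\<phi> x - \<phi> x0\<bar> \<le> 2 * M / e * \<bar>x - x0\<bar>"
proof -
  have chord: "(\<phi> u - \<phi> v) / w * r \<le> 2 * M / e * r"
    if "u \<in> {a..b}" "v \<in> {a..b}" "w \<ge> e" "r \<ge> 0" for u v w r
  proof (rule mult_right_mono)
    have "(\<phi> u - \<phi> v) / w \<le> \<bar>\<phi> u - \<phi> v\<bar> / w"
      using that e by (intro divide_right_mono) auto
    also have "\<dots> \<le> 2 * M / e"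
      using M[OF that(1)] M[OF that(2)] that(3) e(1) by (intro frac_le) auto
    finally show "(\<phi> u - \<phi> v) / w \<le> 2 * M / e" .
  qed fact
  have sub: "convex_on {u..v} \<phi>" if "a \<le> u" "v \<le> b" for u v
    by (rule convex_on_subset[OF conv]) (use that in auto)
  show ?thesis
  proof (cases "x0 \<le> x")
    case True
    have "\<phi> x \<le> (\<phi> b - \<phi> x0) / (b - x0) * (x - x0) + \<phi> x0"
      using True x e by (intro convex_onD_Icc'[OF sub]) auto
    moreover have "\<phi> x0 \<le> (\<phi> a - \<phi> x) / (x - a) * (x - x0) + \<phi> x"
      using True x e by (intro convex_onD_Icc''[OF sub]) auto
    moreover have "(\<phi> b - \<phi> x0) / (b - x0) * (x - x0) \<le> 2 * M / e * (x - x0)"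
      "(\<phi> a - \<phi> x) / (x - a) * (x - x0) \<le> 2 * M / e * (x - x0)"
      using True x e by (intro chord; simp)+
    ultimately have "\<phi> x - \<phi> x0 \<le> 2 * M / e * (x - x0)" "\<phi> x0 - \<phi> x \<le> 2 * M / e * (x - x0)"
      by linarith+
    then show ?thesis using True by (simp only: abs_le_iff) simp
  next
    case False
    have "\<phi> x \<le> (\<phi> a - \<phi> x0) / (x0 - a) * (x0 - x) + \<phi> x0"
      using False x e by (intro convex_onD_Icc''[OF sub]) auto
    moreover have "\<phi> x0 \<le> (\<phi> b - \<phi> x) / (b - x) * (x0 - x) + \<phi> x"
      using False x e by (intro convex_onD_Icc'[OF sub]) auto
    moreover have "(\<phi> a - \<phi> x0) / (x0 - a) * (x0 - x) \<le> 2 * M / e * (x0 - x)"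
      "(\<phi> b - \<phi> x) / (b - x) * (x0 - x) \<le> 2 * M / e * (x0 - x)"
      using False x e by (intro chord; simp)+
    ultimately have "\<phi> x - \<phi> x0 \<le> 2 * M / e * (x0 - x)" "\<phi> x0 - \<phi> x \<le> 2 * M / e * (x0 - x)"
      by linarith+
    then show ?thesis using False by (simp only: abs_le_iff abs_of_neg) simp
  qed
qed

definition separately_convex_on :: "real set \<Rightarrow> real set \<Rightarrow> (real \<Rightarrow> real \<Rightarrow> real) \<Rightarrow> bool" where
  "separately_convex_on A B f \<longleftrightarrow>
    (\<forall>y\<in>B. convex_on A (\<lambda>x. f x y)) \<and> (\<forall>x\<in>A. convex_on B (f x))"

text \<open>Moving from \<open>(x0, y0)\<close> to \<open>(x, y)\<close>, the change of the first variable is controlled by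
  \<open>convex_on_diff_bound\<close> uniformly in \<open>y\<close>, and the change of the second variable takes place on
  the fixed slice \<open>f x0\<close>, which is continuous in the open interval.\<close>
lemma continuous_on_separately_convex:
  assumes f: "separately_convex_on {a..b} {c..d} f"
    and M: "\<And>x y. x \<in> {a..b} \<Longrightarrow> y \<in> {c..d} \<Longrightarrow> \<bar>f x y\<bar> \<le> M"
  shows "continuous_on ({a<..<b} \<times> {c<..<d}) (\<lambda>(x, y). f x y)"
  unfolding continuous_on_def
proof
  fix z assume z: "z \<in> {a<..<b} \<times> {c<..<d}"
  then obtain x0 y0 where z_eq: "z = (x0, y0)" and x0: "a < x0" "x0 < b" and y0: "c < y0" "y0 < d"
    by auto
  let ?F = "at (x0, y0) within {a<..<b} \<times> {c<..<d}"
  define e where "e = min (x0 - a) (b - x0)"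
  have e: "0 < e" "a + e \<le> x0" "x0 \<le> b - e" using x0 by (auto simp: e_def)
  have in_box: "\<forall>\<^sub>F p in ?F. fst p \<in> {a<..<b} \<and> snd p \<in> {c<..<d}"
    unfolding eventually_at_filter by (rule always_eventually) (simp add: mem_Times_iff)
  have fst: "(fst \<longlongrightarrow> x0) ?F" and snd: "(snd \<longlongrightarrow> y0) ?F"
    using tendsto_fst[OF tendsto_ident_at, of "(x0, y0)"] tendsto_snd[OF tendsto_ident_at, of "(x0, y0)"]
    by simp_all
  have "((\<lambda>p. f (fst p) (snd p) - f x0 (snd p)) \<longlongrightarrow> 0) ?F"
  proof (rule Lim_null_comparison)
    show "\<forall>\<^sub>F p in ?F. norm (f (fst p) (snd p) - f x0 (snd p)) \<le> 2 * M / e * \<bar>fst p - x0\<bar>"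
      using in_box
    proof eventually_elim
      case (elim p)
      then show ?case
        using convex_on_diff_bound[of a b "\<lambda>x. f x (snd p)" M e x0 "fst p"] f M e
        by (auto simp: separately_convex_on_def)
    qed
    show "((\<lambda>p. 2 * M / e * \<bar>fst p - x0\<bar>) \<longlongrightarrow> 0) ?F"
      by (rule tendsto_eq_intros fst refl | simp)+
  qed
  moreover have "((\<lambda>p. f x0 (snd p)) \<longlongrightarrow> f x0 y0) ?F"
  proof (rule isCont_tendsto_compose[OF _ snd])
    have "convex_on {c<..<d} (f x0)"
      using f x0 by (auto simp: separately_convex_on_def intro: convex_on_subset[of "{c..d}"])
    then have "continuous_on {c<..<d} (f x0)"
      by (intro convex_on_continuous) auto
    then show "isCont (f x0) y0"
      using y0 by (simp add: continuous_on_eq_continuous_at)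
  qed
  ultimately have "((\<lambda>p. f (fst p) (snd p) - f x0 (snd p) + f x0 (snd p)) \<longlongrightarrow> 0 + f x0 y0) ?F"
    by (rule tendsto_add)
  then show "((\<lambda>(x, y). f x y) \<longlongrightarrow> (case z of (x, y) \<Rightarrow> f x y)) (at z within {a<..<b} \<times> {c<..<d})"
    by (simp add: z_eq case_prod_unfold)
qed

text \<open>The mean of \<open>\<phi>\<close> is also the mean of its reflection \<open>\<lambda>x. \<phi> (a + b - x)\<close>. By convexity the sum
  of \<open>\<phi>\<close> and its reflection lies pointwise between \<open>2 * \<phi> ((a + b) / 2)\<close> and \<open>\<phi> a + \<phi> b\<close>.\<close>
lemma Hermite_Hadamard:
  fixes \<phi> :: "real \<Rightarrow> real"
  assumes "a < b" and conv: "convex_on {a..b} \<phi>" and int: "\<phi> integrable_on {a..b}"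
  shows "\<phi> ((a + b) / 2) \<le> integral {a..b} \<phi> / (b - a)"
    and "integral {a..b} \<phi> / (b - a) \<le> (\<phi> a + \<phi> b) / 2"
proof -
  let ?I = "integral {a..b} \<phi>"
  have I: "(\<phi> has_integral ?I) {a..b}" using int by (rule integrable_integral)
  have img: "(\<lambda>x. a + b - x) ` {a..b} = {a..b}"
    using image_affinity_atLeastAtMost[of "-1" "a + b" a b] \<open>a < b\<close>
    by (simp add: algebra_simps)
  have refl: "((\<lambda>x. \<phi> (a + b - x)) has_integral ?I) {a..b}"
    using has_integral_affinity[of \<phi> ?I a b "-1" "a + b"] I
    by (simp add: img)
  have const: "((\<lambda>_. k) has_integral (b - a) * k) {a..b}" for k :: real
    using has_integral_const_real[of k a b] \<open>a < b\<close> by simp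
  have "2 * \<phi> ((a + b) / 2) \<le> \<phi> x + \<phi> (a + b - x)" if "x \<in> {a..b}" for x
    using convex_onD[OF conv, of "1/2" x "a + b - x"] that by (simp add: field_simps)
  from has_integral_le[OF const has_integral_add[OF I refl] this]
  have "(b - a) * (2 * \<phi> ((a + b) / 2)) \<le> ?I + ?I" .
  then show "\<phi> ((a + b) / 2) \<le> ?I / (b - a)"
    using \<open>a < b\<close> by (simp add: field_simps)
  have "\<phi> x + \<phi> (a + b - x) \<le> \<phi> a + \<phi> b" if "x \<in> {a..b}" for x
  proof -
    \<comment> \<open>The chord over \<open>{a..b}\<close> has slope \<open>k\<close>; its values at \<open>x\<close> and at the mirror image of \<open>x\<close>
      add up to \<open>\<phi> a + \<phi> b\<close>.\<close>
    define k where "k = (\<phi> b - \<phi> a) / (b - a)"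
    have "(\<phi> a - \<phi> b) / (b - a) = - k" by (simp add: k_def diff_divide_distrib)
    then have "\<phi> x \<le> k * (x - a) + \<phi> a" "\<phi> (a + b - x) \<le> - k * (x - a) + \<phi> b"
      using convex_onD_Icc'[OF conv that] convex_onD_Icc''[OF conv, of "a + b - x"] that
      by (simp_all add: k_def)
    then show ?thesis by simp
  qed
  from has_integral_le[OF has_integral_add[OF I refl] const this]
  have "?I + ?I \<le> (b - a) * (\<phi> a + \<phi> b)" .
  then show "?I / (b - a) \<le> (\<phi> a + \<phi> b) / 2"
    using \<open>a < b\<close> by (simp add: field_simps)
qed

text \<open>A convex function is continuous in the open interval, so the criterion for bounded
  functions that are continuous inside a box applies.\<close>
lemma
  fixes \<phi> :: "real \<Rightarrow> real"
  assumes conv: "convex_on {a..b} \<phi>" and M: "\<And>x. x \<in> {a..b} \<Longrightarrow> \<bar>\<phi> x\<bar> \<le> M"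
  shows integrable_on_bounded_convex: "\<phi> integrable_on {a..b}"
    and has_riemann_integral_bounded_convex: "(\<phi> has_riemann_integral integral {a..b} \<phi>) {a..b}"
proof -
  have "convex_on {a<..<b} \<phi>"
    using conv by (rule convex_on_subset) auto
  then have "continuous_on (box a b) \<phi>"
    using convex_on_continuous[of "{a<..<b}" \<phi>] by simp
  then show "\<phi> integrable_on {a..b}" "(\<phi> has_riemann_integral integral {a..b} \<phi>) {a..b}"
    using integrable_on_bounded_continuous_interior[of a b \<phi> M]
      has_riemann_integral_bounded_continuous_interior[of a b \<phi> M] M
    by simp_all
qed

section \<open>The Hermite--Hadamard chain for separately convex functions\<close>

locale bounded_separately_convex =
  fixes a b c d M :: real and f :: "real \<Rightarrow> real \<Rightarrow> real"
  assumes ab: "a < b" and cd: "c < d"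
    and sep: "separately_convex_on {a..b} {c..d} f"
    and bound: "\<And>x y. x \<in> {a..b} \<Longrightarrow> y \<in> {c..d} \<Longrightarrow> \<bar>f x y\<bar> \<le> M"
begin

lemma convex_fst: "y \<in> {c..d} \<Longrightarrow> convex_on {a..b} (\<lambda>x. f x y)"
  and convex_snd: "x \<in> {a..b} \<Longrightarrow> convex_on {c..d} (f x)"
  using sep by (auto simp: separately_convex_on_def)

lemma
  assumes "y \<in> {c..d}"
  shows integrable_fst: "(\<lambda>x. f x y) integrable_on {a..b}"
    and has_riemann_integral_fst:
      "((\<lambda>x. f x y) has_riemann_integral integral {a..b} (\<lambda>x. f x y)) {a..b}"
  by (rule integrable_on_bounded_convex[OF convex_fst] has_riemann_integral_bounded_convex[OF convex_fst];
      use assms bound in blast)+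

lemma
  assumes "x \<in> {a..b}"
  shows integrable_snd: "f x integrable_on {c..d}"
    and has_riemann_integral_snd: "(f x has_riemann_integral integral {c..d} (f x)) {c..d}"
  by (rule integrable_on_bounded_convex[OF convex_snd] has_riemann_integral_bounded_convex[OF convex_snd];
      use assms bound in blast)+

definition marginal :: "real \<Rightarrow> real" where
  "marginal x = integral {c..d} (f x)"

lemma convex_marginal: "convex_on {a..b} marginal"
proof (rule convex_onI)
  fix t x y :: real
  assume t: "0 < t" "t < 1" and x: "x \<in> {a..b}" and y: "y \<in> {a..b}"
  let ?z = "(1 - t) *\<^sub>R x + t *\<^sub>R y"
  have z: "?z \<in> {a..b}"
    using x y t convexD[of "{a..b}" x y "1 - t" t] by auto
  have "integral {c..d} (f ?z) \<le> integral {c..d} (\<lambda>u. (1 - t) * f x u + t * f y u)"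
  proof (rule integral_le)
    show "f ?z integrable_on {c..d}"
      using z by (rule integrable_snd)
    show "(\<lambda>u. (1 - t) * f x u + t * f y u) integrable_on {c..d}"
      by (intro integrable_add integrable_on_mult_right integrable_snd x y)
    show "f ?z u \<le> (1 - t) * f x u + t * f y u" if "u \<in> {c..d}" for u
      using convex_onD[OF convex_fst[OF that]] t x y by auto
  qed
  also have "\<dots> = (1 - t) * integral {c..d} (f x) + t * integral {c..d} (f y)"
    by (subst integral_add)
      (intro integrable_on_mult_right integrable_snd x y | simp)+
  finally show "marginal ?z \<le> (1 - t) * marginal x + t * marginal y"
    by (simp add: marginal_def)
qed simp

lemma bound_marginal:
  assumes "x \<in> {a..b}"
  shows "\<bar>marginal x\<bar> \<le> M * (d - c)"
proof -
  have "norm (integral {c..d} (f x)) \<le> integral {c..d} (\<lambda>_. M)"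
    using assms bound by (intro integral_norm_bound_integral integrable_snd) auto
  also have "\<dots> = M * (d - c)" using cd by simp
  finally show ?thesis by (simp add: marginal_def)
qed

lemma integrable_marginal: "marginal integrable_on {a..b}"
  and has_riemann_integral_marginal:
    "(marginal has_riemann_integral integral {a..b} marginal) {a..b}"
  by (rule integrable_on_bounded_convex[OF convex_marginal bound_marginal]
      has_riemann_integral_bounded_convex[OF convex_marginal bound_marginal]; assumption)+

text \<open>Here \<open>continuous_on_separately_convex\<close> feeds both the integrability criterion on the
  rectangle and Fubini's theorem.\<close>
lemma has_riemann_integral_double:
  "((\<lambda>(x, y). f x y) has_riemann_integral integral {a..b} marginal) ({a..b} \<times> {c..d})"
proof -
  let ?f = "\<lambda>(x, y). f x y"
  have cont: "continuous_on (box (a, c) (b, d)) ?f"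
    using continuous_on_separately_convex[OF sep bound] by (simp add: box_prod)
  have bnd: "\<bar>?f z\<bar> \<le> M" if "z \<in> cbox (a, c) (b, d)" for z
    using that bound by (auto simp: cbox_Pair_eq)
  have "integral (cbox (a, c) (b, d)) ?f = integral {a..b} marginal"
    using integral_box_Pair_iterated[OF bnd[OF subsetD[OF box_subset_cbox]] cont]
    by (simp add: marginal_def[abs_def])
  with has_riemann_integral_bounded_continuous_interior[OF bnd cont]
  show ?thesis by (simp add: cbox_Pair_eq)
qed

lemma midpoint_le_midlines:
  "f ((a + b) / 2) ((c + d) / 2)
    \<le> 1 / 2 * (1 / (b - a) * integral {a..b} (\<lambda>x. f x ((c + d) / 2))
              + 1 / (d - c) * marginal ((a + b) / 2))"
proof -
  have mid: "(a + b) / 2 \<in> {a..b}" "(c + d) / 2 \<in> {c..d}" using ab cd by auto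
  show ?thesis
    using Hermite_Hadamard(1)[OF ab convex_fst[OF mid(2)] integrable_fst[OF mid(2)]]
      Hermite_Hadamard(1)[OF cd convex_snd[OF mid(1)] integrable_snd[OF mid(1)]]
    by (simp add: marginal_def)
qed

text \<open>For the horizontal midline, the value at the midpoint of each vertical slice is at most the
  mean over that slice, and this is integrated over \<open>x\<close>. For the vertical midline, its
  integral is the value of the convex function \<open>marginal\<close> at the midpoint.\<close>
lemma midlines_le_mean:
  "1 / 2 * (1 / (b - a) * integral {a..b} (\<lambda>x. f x ((c + d) / 2))
           + 1 / (d - c) * marginal ((a + b) / 2))
    \<le> 1 / ((b - a) * (d - c)) * integral {a..b} marginal"
proof -
  have "integral {a..b} (\<lambda>x. f x ((c + d) / 2)) \<le> integral {a..b} (\<lambda>x. marginal x / (d - c))"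
  proof (rule integral_le)
    show "f x ((c + d) / 2) \<le> marginal x / (d - c)" if "x \<in> {a..b}" for x
      using Hermite_Hadamard(1)[OF cd convex_snd[OF that] integrable_snd[OF that]]
      by (simp add: marginal_def)
  qed (use cd integrable_fst integrable_marginal in auto)
  then have "1 / (b - a) * integral {a..b} (\<lambda>x. f x ((c + d) / 2))
      \<le> 1 / (b - a) * (integral {a..b} marginal / (d - c))"
    using ab by (intro mult_left_mono) auto
  moreover have "1 / (d - c) * marginal ((a + b) / 2)
      \<le> 1 / (d - c) * (integral {a..b} marginal / (b - a))"
    using Hermite_Hadamard(1)[OF ab convex_marginal integrable_marginal] cd
    by (intro mult_left_mono) auto
  ultimately show ?thesis by (simp add: mult.commute)
qed

text \<open>The mean is bounded twice and the bounds are averaged: the horizontal edges come from the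
  upper Hermite--Hadamard inequality on every vertical slice, the vertical edges from the same
  inequality for \<open>marginal\<close>, whose values at \<open>a\<close> and \<open>b\<close> are the integrals over these edges.\<close>
lemma mean_le_edges:
  "1 / ((b - a) * (d - c)) * integral {a..b} marginal
    \<le> 1 / 4 * (1 / (b - a) * integral {a..b} (\<lambda>x. f x c)
              + 1 / (b - a) * integral {a..b} (\<lambda>x. f x d)
              + 1 / (d - c) * marginal a + 1 / (d - c) * marginal b)"
proof -
  have "integral {a..b} (\<lambda>x. marginal x / (d - c)) \<le> integral {a..b} (\<lambda>x. (f x c + f x d) / 2)"
  proof (rule integral_le)
    show "marginal x / (d - c) \<le> (f x c + f x d) / 2" if "x \<in> {a..b}" for x
      using Hermite_Hadamard(2)[OF cd convex_snd[OF that] integrable_snd[OF that]]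
      by (simp add: marginal_def)
  qed (use cd integrable_fst integrable_marginal in \<open>auto intro!: integrable_add\<close>)
  also have "\<dots> = (integral {a..b} (\<lambda>x. f x c) + integral {a..b} (\<lambda>x. f x d)) / 2"
    using cd integrable_fst by (simp add: integral_add)
  finally have "1 / (b - a) * (integral {a..b} marginal / (d - c))
      \<le> 1 / (b - a) * ((integral {a..b} (\<lambda>x. f x c) + integral {a..b} (\<lambda>x. f x d)) / 2)"
    using ab by (intro mult_left_mono) auto
  then have horizontal: "1 / ((b - a) * (d - c)) * integral {a..b} marginal
      \<le> (1 / (b - a) * integral {a..b} (\<lambda>x. f x c) + 1 / (b - a) * integral {a..b} (\<lambda>x. f x d)) / 2"
    by (simp add: mult.commute add_divide_distrib)
  have "1 / (d - c) * (integral {a..b} marginal / (b - a))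
      \<le> 1 / (d - c) * ((marginal a + marginal b) / 2)"
    using Hermite_Hadamard(2)[OF ab convex_marginal integrable_marginal] cd
    by (intro mult_left_mono) auto
  then have vertical: "1 / ((b - a) * (d - c)) * integral {a..b} marginal
      \<le> (1 / (d - c) * marginal a + 1 / (d - c) * marginal b) / 2"
    by (simp add: mult.commute add_divide_distrib)
  have "m \<le> 1 / 4 * (p + q + r + s)" if "m \<le> (p + q) / 2" "m \<le> (r + s) / 2" for m p q r s :: real
    using that by (simp add: field_simps)
  from this[OF horizontal vertical] show ?thesis .
qed

lemma edges_le_corners:
  "1 / 4 * (1 / (b - a) * integral {a..b} (\<lambda>x. f x c)
           + 1 / (b - a) * integral {a..b} (\<lambda>x. f x d)
           + 1 / (d - c) * marginal a + 1 / (d - c) * marginal b)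
    \<le> 1 / 4 * (f a c + f a d + f b c + f b d)"
proof -
  have ends: "a \<in> {a..b}" "b \<in> {a..b}" "c \<in> {c..d}" "d \<in> {c..d}" using ab cd by auto
  note HH_fst = Hermite_Hadamard(2)[OF ab convex_fst integrable_fst]
  note HH_snd = Hermite_Hadamard(2)[OF cd convex_snd integrable_snd]
  have average: "1 / 4 * (p + q + r + s) \<le> 1 / 4 * (w + x + y + z)"
    if "p \<le> (w + y) / 2" "q \<le> (x + z) / 2" "r \<le> (w + x) / 2" "s \<le> (y + z) / 2"
    for p q r s w x y z :: real
    using that by (simp add: field_simps)
  show ?thesis
    using HH_fst[OF ends(3) ends(3)] HH_fst[OF ends(4) ends(4)]
      HH_snd[OF ends(1) ends(1)] HH_snd[OF ends(2) ends(2)]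
    by (intro average) (simp_all add: marginal_def)
qed

end

section \<open>Interval-valued functions\<close>

text \<open>The second function is negated because it is the negated upper endpoint that is convex
  below.\<close>
lemma interval_integral_endpoints:
  assumes lo: "((\<lambda>t. lower (H t)) has_riemann_integral I) (cbox p q)"
    and up: "((\<lambda>t. - upper (H t)) has_riemann_integral J) (cbox p q)"
  shows "H interval_integrable_on cbox p q"
    and "lower (interval_integral (cbox p q) H) = I"
    and "upper (interval_integral (cbox p q) H) = - J"
proof -
  have up': "((\<lambda>t. upper (H t)) has_riemann_integral - J) (cbox p q)"
    using has_riemann_integral_minus[OF up] by simp
  show H: "H interval_integrable_on cbox p q"
    using lo up' unfolding interval_integrable_on_def riemann_integrable_on_def by blast
  show "lower (interval_integral (cbox p q) H) = I" "upper (interval_integral (cbox p q) H) = - J"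
    by (simp_all add: lower_interval_integral[OF H] upper_interval_integral[OF H]
        riemann_integral_eq[OF lo] riemann_integral_eq[OF up'])
qed

text \<open>Taking two equal points in one variable collapses the four terms of co-ordinated convexity
  to a convex combination of two in the other variable.\<close>
lemma interval_coord_convex_imp_separately_convex:
  assumes F: "interval_coord_convex_on A B F" and AB: "convex A" "convex B"
  shows "separately_convex_on A B (\<lambda>x y. lower (F x y))"
    and "separately_convex_on A B (\<lambda>x y. - upper (F x y))"
proof -
  have fst: "lower (F ((1 - t) *\<^sub>R x + t *\<^sub>R y) u) \<le> (1 - t) * lower (F x u) + t * lower (F y u)
      \<and> (1 - t) * upper (F x u) + t * upper (F y u) \<le> upper (F ((1 - t) *\<^sub>R x + t *\<^sub>R y) u)"
    if "0 < t" "t < 1" "x \<in> A" "y \<in> A" "u \<in> B" for t x y u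
    using F[unfolded interval_coord_convex_on_def, rule_format, of x y u u 1 "1 - t"] that
    by (simp add: interval_superset_iff lower_scale upper_scale)
  have snd: "lower (F x ((1 - s) *\<^sub>R u + s *\<^sub>R w)) \<le> (1 - s) * lower (F x u) + s * lower (F x w)
      \<and> (1 - s) * upper (F x u) + s * upper (F x w) \<le> upper (F x ((1 - s) *\<^sub>R u + s *\<^sub>R w))"
    if "0 < s" "s < 1" "x \<in> A" "u \<in> B" "w \<in> B" for s x u w
    using F[unfolded interval_coord_convex_on_def, rule_format, of x x u w "1 - s" 1] that
    by (simp add: interval_superset_iff lower_scale upper_scale)
  show "separately_convex_on A B (\<lambda>x y. lower (F x y))"
    unfolding separately_convex_on_def
    using fst snd AB by (auto intro!: convex_onI)
  show "separately_convex_on A B (\<lambda>x y. - upper (F x y))"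
    unfolding separately_convex_on_def
    using fst snd AB by (fastforce intro!: convex_onI)
qed

text \<open>The centre of the rectangle is the midpoint of the four points obtained from \<open>(x, y)\<close> by
  reflecting the coordinates. So the upper endpoint at the centre is at least the mean of four
  nonnegative numbers, one of which is the upper endpoint at \<open>(x, y)\<close>.\<close>
lemma interval_coord_convex_upper_le_center:
  assumes F: "interval_coord_convex_on {a..b} {c..d} F"
    and pos: "\<And>x y. x \<in> {a..b} \<Longrightarrow> y \<in> {c..d} \<Longrightarrow> positive_interval (F x y)"
    and x: "x \<in> {a..b}" and y: "y \<in> {c..d}"
  shows "upper (F x y) \<le> 4 * upper (F ((a + b) / 2) ((c + d) / 2))"
proof -
  let ?x = "a + b - x" and ?y = "c + d - y"
  have x': "?x \<in> {a..b}" and y': "?y \<in> {c..d}" using x y by auto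
  have "0 \<le> upper (F x ?y)" "0 \<le> upper (F ?x y)" "0 \<le> upper (F ?x ?y)"
    using pos x y x' y' unfolding positive_interval_def
    by (meson less_imp_le lower_le_upper order_trans)+
  moreover have "(upper (F x y) + upper (F x ?y) + upper (F ?x y) + upper (F ?x ?y)) / 4
      \<le> upper (F ((a + b) / 2) ((c + d) / 2))"
    using F[unfolded interval_coord_convex_on_def, rule_format, OF x x' y y', of "1/2" "1/2"]
    by (simp add: interval_superset_iff lower_scale upper_scale field_simps)
  ultimately show ?thesis by simp
qed

theorem theorem7:
  fixes a b c d :: real and F :: "real \<Rightarrow> real \<Rightarrow> real interval"
  assumes "a < b" and "c < d"
    and "\<forall>x\<in>{a..b}. \<forall>y\<in>{c..d}. positive_interval (F x y)"
    and "interval_coord_convex_on {a..b} {c..d} F"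
  shows
    "(\<forall>y\<in>{c..d}. (\<lambda>x. F x y) interval_integrable_on {a..b}) \<and>
     (\<forall>x\<in>{a..b}. (\<lambda>y. F x y) interval_integrable_on {c..d}) \<and>
     (\<lambda>x. interval_integral {c..d} (\<lambda>y. F x y)) interval_integrable_on {a..b} \<and>
     (\<lambda>(x, y). F x y) interval_integrable_on ({a..b} \<times> {c..d}) \<and>
     interval_integral ({a..b} \<times> {c..d}) (\<lambda>(x, y). F x y) =
       interval_integral {a..b} (\<lambda>x. interval_integral {c..d} (\<lambda>y. F x y)) \<and>
     F ((a + b) / 2) ((c + d) / 2) \<supseteq>\<^sub>I
       (1 / 2) *\<^sub>I ((1 / (b - a)) *\<^sub>I interval_integral {a..b} (\<lambda>x. F x ((c + d) / 2))
                 + (1 / (d - c)) *\<^sub>I interval_integral {c..d} (\<lambda>y. F ((a + b) / 2) y)) \<and>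
     (1 / 2) *\<^sub>I ((1 / (b - a)) *\<^sub>I interval_integral {a..b} (\<lambda>x. F x ((c + d) / 2))
               + (1 / (d - c)) *\<^sub>I interval_integral {c..d} (\<lambda>y. F ((a + b) / 2) y)) \<supseteq>\<^sub>I
       (1 / ((b - a) * (d - c))) *\<^sub>I
         interval_integral {a..b} (\<lambda>x. interval_integral {c..d} (\<lambda>y. F x y)) \<and>
     (1 / ((b - a) * (d - c))) *\<^sub>I
         interval_integral {a..b} (\<lambda>x. interval_integral {c..d} (\<lambda>y. F x y)) \<supseteq>\<^sub>I
       (1 / 4) *\<^sub>I ((1 / (b - a)) *\<^sub>I interval_integral {a..b} (\<lambda>x. F x c)
                 + (1 / (b - a)) *\<^sub>I interval_integral {a..b} (\<lambda>x. F x d)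
                 + (1 / (d - c)) *\<^sub>I interval_integral {c..d} (\<lambda>y. F a y)
                 + (1 / (d - c)) *\<^sub>I interval_integral {c..d} (\<lambda>y. F b y)) \<and>
     (1 / 4) *\<^sub>I ((1 / (b - a)) *\<^sub>I interval_integral {a..b} (\<lambda>x. F x c)
               + (1 / (b - a)) *\<^sub>I interval_integral {a..b} (\<lambda>x. F x d)
               + (1 / (d - c)) *\<^sub>I interval_integral {c..d} (\<lambda>y. F a y)
               + (1 / (d - c)) *\<^sub>I interval_integral {c..d} (\<lambda>y. F b y)) \<supseteq>\<^sub>I
       (1 / 4) *\<^sub>I (F a c + F a d + F b c + F b d)"
proof -
  define M where "M = 4 * upper (F ((a + b) / 2) ((c + d) / 2))"
  have bounds: "0 < lower (F x y)" "upper (F x y) \<le> M" if "x \<in> {a..b}" "y \<in> {c..d}" for x y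
    using interval_coord_convex_upper_le_center[OF assms(4)] assms(3) that
    by (auto simp: M_def positive_interval_def)
  have abs: "\<bar>lower (F x y)\<bar> \<le> M" "\<bar>- upper (F x y)\<bar> \<le> M" if "x \<in> {a..b}" "y \<in> {c..d}" for x y
    using bounds[OF that] lower_le_upper[of "F x y"] by linarith+
  interpret lo: bounded_separately_convex a b c d M "\<lambda>x y. lower (F x y)"
    using assms abs interval_coord_convex_imp_separately_convex(1)[OF assms(4)]
    by unfold_locales auto
  interpret up: bounded_separately_convex a b c d M "\<lambda>x y. - upper (F x y)"
    using assms abs interval_coord_convex_imp_separately_convex(2)[OF assms(4)]
    by unfold_locales auto

  have fst:
    "(\<lambda>x. F x y) interval_integrable_on {a..b}"
    "lower (interval_integral {a..b} (\<lambda>x. F x y)) = integral {a..b} (\<lambda>x. lower (F x y))"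
    "upper (interval_integral {a..b} (\<lambda>x. F x y)) = - integral {a..b} (\<lambda>x. - upper (F x y))"
    if "y \<in> {c..d}" for y
    using interval_integral_endpoints[of "\<lambda>x. F x y" _ a b]
      lo.has_riemann_integral_fst[OF that] up.has_riemann_integral_fst[OF that]
    by (simp_all only: cbox_interval)
  have snd:
    "F x interval_integrable_on {c..d}"
    "lower (interval_integral {c..d} (F x)) = lo.marginal x"
    "upper (interval_integral {c..d} (F x)) = - up.marginal x"
    if "x \<in> {a..b}" for x
    using interval_integral_endpoints[of "F x" _ c d]
      lo.has_riemann_integral_snd[OF that] up.has_riemann_integral_snd[OF that]
    by (simp_all only: cbox_interval lo.marginal_def up.marginal_def)
  let ?G = "\<lambda>x. interval_integral {c..d} (F x)"
  have "((\<lambda>x. lower (?G x)) has_riemann_integral integral {a..b} lo.marginal) {a..b}"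
    "((\<lambda>x. - upper (?G x)) has_riemann_integral integral {a..b} up.marginal) {a..b}"
    using lo.has_riemann_integral_marginal up.has_riemann_integral_marginal
    by (subst has_riemann_integral_cong; simp add: snd)+
  then have iterated:
    "?G interval_integrable_on {a..b}"
    "lower (interval_integral {a..b} ?G) = integral {a..b} lo.marginal"
    "upper (interval_integral {a..b} ?G) = - integral {a..b} up.marginal"
    using interval_integral_endpoints[of ?G _ a b]
    by (simp_all only: cbox_interval)
  have "((\<lambda>z. lower (case z of (x, y) \<Rightarrow> F x y)) has_riemann_integral integral {a..b} lo.marginal)
      (cbox (a, c) (b, d))"
    "((\<lambda>z. - upper (case z of (x, y) \<Rightarrow> F x y)) has_riemann_integral integral {a..b} up.marginal)
      (cbox (a, c) (b, d))"
    using lo.has_riemann_integral_double up.has_riemann_integral_double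
    by (simp_all add: cbox_Pair_eq case_prod_unfold)
  note double = interval_integral_endpoints[OF this, unfolded cbox_Pair_eq, unfolded cbox_interval]

  have mem: "a \<in> {a..b}" "b \<in> {a..b}" "(a + b) / 2 \<in> {a..b}"
    "c \<in> {c..d}" "d \<in> {c..d}" "(c + d) / 2 \<in> {c..d}"
    using assms(1,2) by auto
  note endpoints = interval_superset_iff lower_scale upper_scale lower_plus upper_plus
    less_imp_le[OF assms(1)] less_imp_le[OF assms(2)]
    fst(2,3)[OF mem(4)] fst(2,3)[OF mem(5)] fst(2,3)[OF mem(6)]
    snd(2,3)[OF mem(1)] snd(2,3)[OF mem(2)] snd(2,3)[OF mem(3)] iterated(2,3)
  show ?thesis
    apply (intro conjI ballI)
    subgoal by (rule fst)
    subgoal by (rule snd)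
    subgoal by (rule iterated)
    subgoal by (rule double)
    subgoal by (rule interval_eqI) (simp_all only: double iterated)
    subgoal using lo.midpoint_le_midlines up.midpoint_le_midlines by (simp add: endpoints)
    subgoal using lo.midlines_le_mean up.midlines_le_mean by (simp add: endpoints)
    subgoal using lo.mean_le_edges up.mean_le_edges by (simp add: endpoints)
    subgoal using lo.edges_le_corners up.edges_le_corners by (simp add: endpoints)
    done
qed

end
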